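(* Let $N\ge 2$, $\Gamma=\{1,\dots,N\}$, let $i\in\Gamma$, let $\mathbf{g}_k\in\mathbb{R}^p$ for $k\in\Gamma\setminus\{i\}$, and let $\hat{\mathbf{g}}_i\in\mathbb{R}^p$. Let $\mathcal{A}(\mathbf{x}_1,\dots,\mathbf{x}_N)=\sum_{k\in\Gamma}\alpha_k\mathbf{x}_k$ with fixed weights $\alpha_k\in[0,1]$, $\sum_{k\in\Gamma}\alpha_k=1$, and $\alpha_i>0$. For a real number $c$ let $$\mathbf{g}=\mathcal{A}(\mathbf{g}_1,\dots,\hat{\mathbf{g}}_i,\dots,\mathbf{g}_N),\qquad \mathbf{g}'=\mathcal{A}(\mathbf{g}_1,\dots,c\,\hat{\mathbf{g}}_i,\dots,\mathbf{g}_N),$$ where $\hat{\mathbf{g}}_i$ (respectively $c\,\hat{\mathbf{g}}_i$) is in the $i$-th position and $\mathbf{g}_k$ is in the $k$-th position for every $k\ne i$. Let $j\in\Gamma$, $j\ne i$, and assume that $\hat{\mathbf{g}}_i$, $\mathbf{g}_j$, $\mathbf{g}$ and $\mathbf{g}'$ are nonzero. Suppose that $\cos(\mathbf{g},\hat{\mathbf{g}}_i)>\cos(\mathbf{g},\mathbf{g}_j)$, where $\cos(\cdot,\cdot)$ denotes the cosine distance. If $$c\ \ge\ \frac{\|\hat{\mathbf{g}}_i\|\,(\mathbf{g}\cdot\mathbf{g}_j)-\|\mathbf{g}_j\|\,(\mathbf{g}\cdot\hat{\mathbf{g}}_i)}{\alpha_i\,\|\hat{\mathbf{g}}_i\|\,\bigl(\|\mathbf{g}_j\|\,\|\hat{\mathbf{g}}_i\|-\hat{\mathbf{g}}_i\cdot\mathbf{g}_j\bigr)}+1,$$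 then $\cos(\mathbf{g}',c\,\hat{\mathbf{g}}_i)\le\cos(\mathbf{g}',\mathbf{g}_j)$.
   Context: Here $\cos$ denotes the cosine DISTANCE (not the cosine similarity): for nonzero vectors $\mathbf{a},\mathbf{b}\in\mathbb{R}^p$, $\cos(\mathbf{a},\mathbf{b})=1-\frac{\mathbf{a}\cdot\mathbf{b}}{\|\mathbf{a}\|\,\|\mathbf{b}\|}$, where $\mathbf{a}\cdot\mathbf{b}$ is the standard inner product and $\|\cdot\|$ the Euclidean norm. In the federated learning setting, $\mathbf{g}_k$ is the local model update of client $k$, $\hat{\mathbf{g}}_i$ is the update sent by malicious client $i$ (a predicted global model update), $\mathcal{A}$ is the server's aggregation rule, and $\mathbf{g},\mathbf{g}'$ are the aggregated global model updates. *)

theory Defs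
  imports "HOL-Analysis.Analysis"
begin

text \<open>Cosine distance, not cosine similarity; meaningful for nonzero arguments only.\<close>

definition cos_dist :: "real ^ 'p \<Rightarrow> real ^ 'p \<Rightarrow> real" where
  "cos_dist a b = 1 - (a \<bullet> b) / (norm a * norm b)"

definition aggregate :: "nat \<Rightarrow> (nat \<Rightarrow> real) \<Rightarrow> (nat \<Rightarrow> real ^ 'p) \<Rightarrow> real ^ 'p" where
  "aggregate N \<alpha> x = (\<Sum>k\<in>{1..N}. \<alpha> k *\<^sub>R x k)"

end

theory Submission
  imports Defs
begin

text \<open>Scaling \<open>ghat\<close> by \<open>c\<close> moves the aggregate along \<open>ghat\<close>, to \<open>g + (c - 1) \<alpha>\<^sub>i ghat\<close>.
  After clearing the positive norms, the conclusion is linear in \<open>c\<close> and is exactly the assumed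
  bound. The denominator of that bound is positive: equality in Cauchy-Schwarz would make \<open>ghat\<close>
  and \<open>g\<^sub>j\<close> positively parallel, hence equally distant from \<open>g\<close>.\<close>

lemma aggregate_fun_upd:
  assumes "i \<in> {1..N}"
  shows "aggregate N \<alpha> (x(i := v)) = aggregate N \<alpha> (x(i := u)) + \<alpha> i *\<^sub>R (v - u)"
proof -
  have "(\<Sum>k\<in>{1..N} - {i}. \<alpha> k *\<^sub>R (x(i := v)) k) = (\<Sum>k\<in>{1..N} - {i}. \<alpha> k *\<^sub>R (x(i := u)) k)"
    by (rule sum.cong) auto
  then show ?thesis
    using assms by (simp add: aggregate_def sum.remove[of _ i] scaleR_diff_right)
qed

text \<open>The common factor \<open>norm x\<close> cancels and the other two norms are cleared.
  Negated, this turns the hypothesis on \<open>g\<close> into \<open>?T > 0\<close>; directly, it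
  handles the goal on \<open>g'\<close>.\<close>

lemma cos_dist_le_iff:
  assumes "x \<noteq> 0" "a \<noteq> 0" "b \<noteq> 0"
  shows "cos_dist x a \<le> cos_dist x b \<longleftrightarrow> norm a * (x \<bullet> b) \<le> norm b * (x \<bullet> a)"
  using assms by (simp add: cos_dist_def field_simps)

lemma cos_dist_scaleR_right:
  assumes "c > 0"
  shows "cos_dist x (c *\<^sub>R a) = cos_dist x a"
  using assms by (simp add: cos_dist_def)

theorem proposition2:
  fixes N i j :: nat
    and \<alpha> :: "nat \<Rightarrow> real"
    and gs :: "nat \<Rightarrow> real ^ 'p"
    and ghat g g' :: "real ^ 'p"
    and c :: real
  assumes "N \<ge> 2"
    and "i \<in> {1..N}"
    and "\<And>k. k \<in> {1..N} \<Longrightarrow> \<alpha> k \<in> {0..1}"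
    and "(\<Sum>k\<in>{1..N}. \<alpha> k) = 1"
    and "\<alpha> i > 0"
    and "g = aggregate N \<alpha> (gs(i := ghat))"
    and "g' = aggregate N \<alpha> (gs(i := c *\<^sub>R ghat))"
    and "j \<in> {1..N}" and "j \<noteq> i"
    and "ghat \<noteq> 0" and "gs j \<noteq> 0" and "g \<noteq> 0" and "g' \<noteq> 0"
    and "cos_dist g ghat > cos_dist g (gs j)"
    and "c \<ge> (norm ghat * (g \<bullet> gs j) - norm (gs j) * (g \<bullet> ghat))
              / (\<alpha> i * norm ghat * (norm (gs j) * norm ghat - ghat \<bullet> gs j)) + 1"
  shows "cos_dist g' (c *\<^sub>R ghat) \<le> cos_dist g' (gs j)"
proof -
  let ?s = "(c - 1) * \<alpha> i"
  let ?T = "norm ghat * (g \<bullet> gs j) - norm (gs j) * (g \<bullet> ghat)"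
  let ?D = "norm (gs j) * norm ghat - ghat \<bullet> gs j"
  have g': "g' = g + ?s *\<^sub>R ghat"
    unfolding assms(6,7) aggregate_fun_upd[OF assms(2), of _ _ "c *\<^sub>R ghat" ghat]
    by (simp add: algebra_simps)
  have T: "?T > 0"
    using assms(14) cos_dist_le_iff[OF assms(12,10,11)] by auto
  have "?D \<noteq> 0"
  proof
    assume "?D = 0"
    then have "norm ghat *\<^sub>R gs j = norm (gs j) *\<^sub>R ghat"
      using norm_cauchy_schwarz_eq[of ghat "gs j"] by (simp add: mult.commute)
    \<comment> \<open>Pairing with \<open>g\<close> forces \<open>?T = 0\<close>.\<close>
    then have "g \<bullet> (norm ghat *\<^sub>R gs j) = g \<bullet> (norm (gs j) *\<^sub>R ghat)"
      by (rule arg_cong)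
    with T show False by simp
  qed
  then have "?D > 0"
    using norm_cauchy_schwarz[of ghat "gs j"] by (simp add: mult.commute)
  then have den: "\<alpha> i * norm ghat * ?D > 0"
    using assms(5,10) by simp
  have bound: "c - 1 \<ge> ?T / (\<alpha> i * norm ghat * ?D)"
    using assms(15) by simp
  \<comment> \<open>So \<open>c > 1\<close>; the sign matters because a negative factor would
    reverse the direction of \<open>ghat\<close>.\<close>
  moreover have "?T / (\<alpha> i * norm ghat * ?D) > 0"
    using T den by (rule divide_pos_pos)
  ultimately have "c > 0" by linarith
  have "?T \<le> (c - 1) * (\<alpha> i * norm ghat * ?D)"
    using bound den by (simp only: pos_divide_le_eq)
  \<comment> \<open>With \<open>g'\<close> expanded, left minus right side is
    \<open>?T - ?s * norm ghat * ?D\<close>; writing \<open>ghat \<bullet> ghat\<close> as a squared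
    norm exposes the factor \<open>norm ghat\<close>.\<close>
  then have "norm ghat * (g' \<bullet> gs j) \<le> norm (gs j) * (g' \<bullet> ghat)"
    unfolding g' inner_add_left inner_scaleR_left power2_norm_eq_inner[symmetric]
    by (simp add: algebra_simps power2_eq_square)
  then show ?thesis
    unfolding cos_dist_scaleR_right[OF \<open>c > 0\<close>] cos_dist_le_iff[OF assms(13,10,11)] .
qed

end
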